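(* Let $\mathcal{X}\subset\mathbb{R}^n$ be a convex set, and let $D:=\max_{x,x'\in\mathcal{X}}\|x-x'\|$. Let $p\ge1$, $\tau\in(0,1]$, and let $F:\mathbb{R}^n\to\mathbb{R}^n$ satisfy $\|\nabla^{p-1}F(x)-\nabla^{p-1}F(y)\|\le L_p\|x-y\|$, with $\mathrm{VI}_{\mathcal{X}}(F(x))\ne\emptyset$. Let $\{x^k\}_{k\ge1}$ and $\{x^{k+0.5}\}_{k\ge1}$ be generated by ARE (defined in the context). Suppose that $F$ is strongly monotone with modulus $\mu>0$, let $x^*$ be the unique element of $\mathrm{VI}_{\mathcal{X}}(F(x))$, and suppose that $\tilde F(\cdot\,;x^k)$ is such that the bound $\|\tilde F(x;y)-F(x)\|\le\tau L_p\|x-y\|^p$ holds (with $y=x^k$). Restart ARE (as described in the context) after each $N_i=N$ iterations in epoch $i$, where $$N=\left(\frac{L_p}{2\delta\mu}\right)^{\frac{2}{p+1}}\left(\frac{D_0^2}{1-\tau^2}\right)^{\frac{p-1}{p+1}},$$ $0<\delta<1$ is a constant independent of the problem, and $D_0=\|x^1-x^*\|$ is the distance to the solution from the very first initial iterate before any restart. Then the total number of epochs $m$ required to obtain an output $\bar x_{N_m}$ such that $\|\bar x_{N_m}-x^*\|^2\le\epsilon$ is $$\mathcal{O}\left(\log_{\frac{p+1}{2}}\log_2\frac{D^2}{\epsilon}\right)\ \text{ if }p>1,\qquad \mathcal{O}\left(\log_2\frac{D^2}{\epsilon}\right)\ \text{ if }p=1,$$ and the total iteration complexity $mN$ is $$\mathcal{O}\left(\left(\frac{L_p}{\mu}\right)^{\frac{2}{p+1}}(D^2)^{\frac{p-1}{p+1}}\log_{\frac{p+1}{2}}\log_2\frac{D^2}{\epsilon}\right)\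 \text{ if }p>1,\qquad \mathcal{O}\left(\frac{L_1}{\mu}\log_2\frac{D^2}{\epsilon}\right)\ \text{ if }p=1.$$
   Context: $\|\cdot\|$ is the Euclidean norm (and the corresponding norm for derivative tensors); $\nabla^{p-1}F$ is the $(p-1)$-th derivative of $F$, with $\nabla^0F=F$. For a mapping $T:\mathbb{R}^n\to\mathbb{R}^n$, $\mathrm{VI}_{\mathcal{X}}(T(x)):=\{x^*\in\mathcal{X}\mid\langle T(x^* ),x-x^*\rangle\ge0\ \text{for all }x\in\mathcal{X}\}$. $F$ is strongly monotone with modulus $\mu>0$ if $\langle F(x)-F(y),x-y\rangle\ge\mu\|x-y\|^2$ for all $x,y\in\mathcal{X}$. For each $y\in\mathcal{X}$, $\tilde F(\cdot\,;y):\mathbb{R}^n\to\mathbb{R}^n$ is an approximation of $F$ at $y$. ARE (Approximation-based Regularized Extra-gradient method): for $k=1,2,\dots$, let $x^{k+0.5}$ be any element of $\mathrm{VI}_{\mathcal{X}}\left(\tilde F(x;x^k)+L_p\|x-x^k\|^{p-1}(x-x^k)\right)$ (with $x$ the variable and $x^k$ fixed), put $\gamma_k:=L_p\|x^{k+0.5}-x^k\|^{p-1}$, and let $x^{k+1}:=\arg\min_{x\in\mathcal{X}}\langle F(x^{k+0.5}),x-x^k\rangle+\frac{\gamma_k}{2}\|x-x^k\|^2$. Restarting: in epoch $m=1,2,\dots$, $N_m$ ARE iterations $k=1,\dots,N_m$ are performed from the initial iterate $x^1$ of that epoch. The output of the epoch is $\bar x_{N_m}:=\Gamma_{N_m}^{-1}\sum_{k=1}^{N_m}\gamma_k^{-1}x^{k+0.5}$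 with $\Gamma_{N_m}:=\sum_{k=1}^{N_m}\gamma_k^{-1}$, and it is taken as the initial iterate $x^1$ of epoch $m+1$.
   Formalization: For p>1, τ<1 is required (N divides by 1-τ²); N is the formula rounded up to a positive integer, and for p>1 the bound on mN is claimed when the formula is at least 1; if some γ_k=0 the epoch output is x^{k+0.5}; L_p>0 and x^1 in X are assumed. *)

theory Defs
  imports "HOL-Analysis.Analysis"
begin

text \<open>
  The constants hidden in the \<open>O\<close> of a complexity bound must not depend on the dimension \<open>n\<close>, so
  \<open>n\<close> has to be a term that is quantified after those constants, and cannot be an index type. The
  spaces \<open>\<real>\<^sup>n\<close> are therefore taken to be the subspaces of the first \<open>n\<close> coordinates of the real
  sequences with finite support, with the standard inner product.
\<close>

typedef fseq = "{f :: nat \<Rightarrow> real. finite {i. f i \<noteq> 0}}"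
  morphisms coord Abs_fseq
  by (rule exI[of _ "\<lambda>_. 0"]) simp

setup_lifting type_definition_fseq

lemma finite_coord: "finite {i. coord x i \<noteq> 0}"
  using coord[of x] by simp

instantiation fseq :: real_vector
begin

lift_definition zero_fseq :: fseq is "\<lambda>_. 0" by simp

lift_definition plus_fseq :: "fseq \<Rightarrow> fseq \<Rightarrow> fseq" is "\<lambda>f g i. f i + g i"
  subgoal for f g
    by (rule finite_subset[of _ "{i. f i \<noteq> 0} \<union> {i. g i \<noteq> 0}"]) auto
  done

lift_definition uminus_fseq :: "fseq \<Rightarrow> fseq" is "\<lambda>f i. - f i" by simp

lift_definition minus_fseq :: "fseq \<Rightarrow> fseq \<Rightarrow> fseq" is "\<lambda>f g i. f i - g i"
  subgoal for f g
    by (rule finite_subset[of _ "{i. f i \<noteq> 0} \<union> {i. g i \<noteq> 0}"]) auto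
  done

lift_definition scaleR_fseq :: "real \<Rightarrow> fseq \<Rightarrow> fseq" is "\<lambda>r f i. r * f i"
  subgoal for r f
    by (rule finite_subset[of _ "{i. f i \<noteq> 0}"]) auto
  done

instance
  by standard (transfer; simp add: algebra_simps)+

end

lemmas coord_simps [simp] =
  zero_fseq.rep_eq plus_fseq.rep_eq uminus_fseq.rep_eq minus_fseq.rep_eq scaleR_fseq.rep_eq

instantiation fseq :: real_inner
begin

definition inner_fseq :: "fseq \<Rightarrow> fseq \<Rightarrow> real" where
  "inner_fseq x y = (\<Sum>i | coord x i \<noteq> 0. coord x i * coord y i)"

definition norm_fseq :: "fseq \<Rightarrow> real" where
  "norm_fseq x = sqrt (inner x x)"

definition dist_fseq :: "fseq \<Rightarrow> fseq \<Rightarrow> real" where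
  "dist_fseq x y = norm (x - y)"

definition sgn_fseq :: "fseq \<Rightarrow> fseq" where
  "sgn_fseq x = x /\<^sub>R norm x"

definition uniformity_fseq :: "(fseq \<times> fseq) filter" where
  "uniformity_fseq = (INF e\<in>{0<..}. principal {(x, y). dist x y < e})"

definition open_fseq :: "fseq set \<Rightarrow> bool" where
  "open_fseq U \<longleftrightarrow> (\<forall>x\<in>U. eventually (\<lambda>(x', y). x' = x \<longrightarrow> y \<in> U) uniformity)"

lemma inner_fseq_superset:
  assumes "finite A" "\<And>i. i \<notin> A \<Longrightarrow> coord x i * coord y i = 0"
  shows "inner x y = (\<Sum>i\<in>A. coord x i * coord y i)"
  unfolding inner_fseq_def using assms finite_coord[of x]
  by (intro sum.mono_neutral_cong) auto

instance
proof
  fix x y z :: fseq and r :: real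
  let ?A = "{i. coord x i \<noteq> 0} \<union> {i. coord y i \<noteq> 0} \<union> {i. coord z i \<noteq> 0}"
  have A: "finite ?A" using finite_coord by simp
  have in_A: "inner u v = (\<Sum>i\<in>?A. coord u i * coord v i)"
    if "\<forall>i. i \<notin> ?A \<longrightarrow> coord u i = 0" for u v :: fseq
    using that by (intro inner_fseq_superset[OF A]) simp
  have xy: "inner x y = (\<Sum>i\<in>?A. coord x i * coord y i)"
    and yx: "inner y x = (\<Sum>i\<in>?A. coord y i * coord x i)"
    and xz: "inner x z = (\<Sum>i\<in>?A. coord x i * coord z i)"
    and yz: "inner y z = (\<Sum>i\<in>?A. coord y i * coord z i)"
    and xyz: "inner (x + y) z = (\<Sum>i\<in>?A. coord (x + y) i * coord z i)"
    and rx: "inner (r *\<^sub>R x) y = (\<Sum>i\<in>?A. coord (r *\<^sub>R x) i * coord y i)"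
    by (rule in_A; simp)+
  show "inner x y = inner y x"
    unfolding xy yx by (simp add: mult.commute)
  show "inner (x + y) z = inner x z + inner y z"
    unfolding xyz xz yz by (simp add: distrib_right sum.distrib)
  show "inner (r *\<^sub>R x) y = r * inner x y"
    unfolding rx xy by (simp add: mult.assoc sum_distrib_left)
  show "0 \<le> inner x x"
    by (simp add: inner_fseq_def sum_nonneg)
  have "inner x x = 0 \<longleftrightarrow> (\<forall>i. coord x i = 0)"
    using finite_coord[of x] by (auto simp: inner_fseq_def sum_nonneg_eq_0_iff)
  then show "inner x x = 0 \<longleftrightarrow> x = 0"
    using coord_inject[of x 0] by (simp add: fun_eq_iff)
qed (simp_all only: norm_fseq_def dist_fseq_def sgn_fseq_def uniformity_fseq_def open_fseq_def)

end

definition Rn :: "nat \<Rightarrow> fseq set" where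
  "Rn n = {x. \<forall>i\<ge>n. coord x i = 0}"

lemma subspace_Rn: "subspace (Rn n)"
  by (auto simp: subspace_def Rn_def)

lemma inner_Rn:
  assumes "x \<in> Rn n"
  shows "inner x y = (\<Sum>i<n. coord x i * coord y i)"
  using assms by (intro inner_fseq_superset) (auto simp: Rn_def not_less)

lemma ex1_Rn: "\<exists>!x. x \<in> Rn n \<and> (\<forall>i<n. coord x i = f i)"
proof
  let ?g = "\<lambda>i. if i < n then f i else 0"
  have "finite {i. ?g i \<noteq> 0}"
    by (rule finite_subset[of _ "{..<n}"]) auto
  then have "coord (Abs_fseq ?g) = ?g"
    by (intro Abs_fseq_inverse) simp
  then show "Abs_fseq ?g \<in> Rn n \<and> (\<forall>i<n. coord (Abs_fseq ?g) i = f i)"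
    by (simp add: Rn_def)
next
  fix x assume "x \<in> Rn n \<and> (\<forall>i<n. coord x i = f i)"
  then have "coord x = (\<lambda>i. if i < n then f i else 0)"
    by (auto simp: Rn_def)
  then show "x = Abs_fseq (\<lambda>i. if i < n then f i else 0)"
    by (metis coord_inverse)
qed

definition VI :: "'a::real_inner set \<Rightarrow> ('a \<Rightarrow> 'a) \<Rightarrow> 'a set" where
  "VI X T = {z \<in> X. \<forall>x\<in>X. T z \<bullet> (x - z) \<ge> 0}"

definition strongly_monotone_on :: "'a::real_inner set \<Rightarrow> real \<Rightarrow> ('a \<Rightarrow> 'a) \<Rightarrow> bool" where
  "strongly_monotone_on X \<mu> F \<longleftrightarrow>
     \<mu> > 0 \<and> (\<forall>x\<in>X. \<forall>y\<in>X. (F x - F y) \<bullet> (x - y) \<ge> \<mu> * (norm (x - y))\<^sup>2)"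

text \<open>
  \<open>T x [v\<^sub>1, \<dots>, v\<^sub>j]\<close> is the value of the \<open>j\<close>-th derivative tensor of \<open>F\<close> at \<open>x\<close> on directions
  \<open>v\<^sub>1, \<dots>, v\<^sub>j\<close> of the finite-dimensional space \<open>E\<close>. Since \<open>E\<close> has finite dimension, differentiating
  the tensor for each fixed tuple of directions is the same as differentiating it in operator norm.
  Only arguments in \<open>E\<close> are relevant; that \<open>has_derivative\<close> wants a bounded linear map on the whole
  type is no restriction, as a linear map on \<open>E\<close> can be composed with the orthogonal projection.
\<close>

definition derivative_tensors ::
    "'a::real_inner set \<Rightarrow> nat \<Rightarrow> ('a \<Rightarrow> 'a) \<Rightarrow> ('a \<Rightarrow> 'a list \<Rightarrow> 'a) \<Rightarrow> bool" where
  "derivative_tensors E k F T \<longleftrightarrow>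
     (\<forall>x\<in>E. T x [] = F x) \<and>
     (\<forall>vs. set vs \<subseteq> E \<and> length vs < k \<longrightarrow>
        (\<forall>x\<in>E. ((\<lambda>y. T y vs) has_derivative (\<lambda>v. T x (v # vs))) (at x within E)))"

definition tensor_norm :: "'a::real_inner set \<Rightarrow> nat \<Rightarrow> ('a list \<Rightarrow> 'a) \<Rightarrow> real" where
  "tensor_norm E k A =
     (SUP vs \<in> {vs. length vs = k \<and> (\<forall>v\<in>set vs. v \<in> E \<and> norm v \<le> 1)}. norm (A vs))"

definition Lipschitz_derivative ::
    "'a::real_inner set \<Rightarrow> 'a set \<Rightarrow> nat \<Rightarrow> real \<Rightarrow> ('a \<Rightarrow> 'a) \<Rightarrow> bool" where
  "Lipschitz_derivative E X k L F \<longleftrightarrow>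
     (\<exists>T. derivative_tensors E k F T \<and>
        (\<forall>x\<in>X. \<forall>y\<in>X. tensor_norm E k (\<lambda>vs. T x vs - T y vs) \<le> L * norm (x - y)))"

text \<open>
  In the following, \<open>x k\<close> and \<open>xh k\<close> stand for the iterates \<open>x\<^sup>k\<close> and \<open>x\<^sup>k\<^sup>+\<^sup>0\<^sup>.\<^sup>5\<close>, and
  \<open>Ft z y\<close> is the value at \<open>z\<close> of the approximation of \<open>F\<close> at \<open>y\<close>.
\<close>

definition ARE_gamma ::
    "real \<Rightarrow> nat \<Rightarrow> (nat \<Rightarrow> 'a::real_inner) \<Rightarrow> (nat \<Rightarrow> 'a) \<Rightarrow> nat \<Rightarrow> real" where
  "ARE_gamma L p x xh k = L * norm (xh k - x k) ^ (p - 1)"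

definition ARE_run ::
    "'a::real_inner set \<Rightarrow> ('a \<Rightarrow> 'a) \<Rightarrow> ('a \<Rightarrow> 'a \<Rightarrow> 'a) \<Rightarrow> real \<Rightarrow> nat \<Rightarrow> nat \<Rightarrow>
      (nat \<Rightarrow> 'a) \<Rightarrow> (nat \<Rightarrow> 'a) \<Rightarrow> bool" where
  "ARE_run X F Ft L p N x xh \<longleftrightarrow>
     x 1 \<in> X \<and>
     (\<forall>k\<in>{1..N}.
        xh k \<in> VI X (\<lambda>z. Ft z (x k) + (L * norm (z - x k) ^ (p - 1)) *\<^sub>R (z - x k)) \<and>
        is_arg_min
          (\<lambda>z. F (xh k) \<bullet> (z - x k) + ARE_gamma L p x xh k / 2 * (norm (z - x k))\<^sup>2)
          (\<lambda>z. z \<in> X) (x (Suc k)))"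

text \<open>
  If \<open>\<gamma>\<^sub>k = 0\<close>, the weight \<open>1 / \<gamma>\<^sub>k\<close> is infinite. This can happen only for \<open>p > 1\<close> and
  \<open>x\<^sup>k\<^sup>+\<^sup>0\<^sup>.\<^sup>5 = x\<^sup>k\<close>, and the weighted average is then understood to be that point (the first one, if
  there are several). Without this case distinction, division by zero would give it the weight zero.
\<close>

definition ARE_output ::
    "real \<Rightarrow> nat \<Rightarrow> nat \<Rightarrow> (nat \<Rightarrow> 'a::real_inner) \<Rightarrow> (nat \<Rightarrow> 'a) \<Rightarrow> 'a" where
  "ARE_output L p N x xh =
     (if \<exists>k\<in>{1..N}. ARE_gamma L p x xh k = 0
      then xh (LEAST k. k \<in> {1..N} \<and> ARE_gamma L p x xh k = 0)
      else (1 / (\<Sum>k=1..N. 1 / ARE_gamma L p x xh k)) *\<^sub>R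
             (\<Sum>k=1..N. (1 / ARE_gamma L p x xh k) *\<^sub>R xh k))"

text \<open>The first argument of \<open>x\<close> and \<open>xh\<close> is the epoch \<open>m \<ge> 1\<close>.\<close>

definition restarted_ARE ::
    "'a::real_inner set \<Rightarrow> ('a \<Rightarrow> 'a) \<Rightarrow> ('a \<Rightarrow> 'a \<Rightarrow> 'a) \<Rightarrow> real \<Rightarrow> nat \<Rightarrow> nat \<Rightarrow>
      (nat \<Rightarrow> nat \<Rightarrow> 'a) \<Rightarrow> (nat \<Rightarrow> nat \<Rightarrow> 'a) \<Rightarrow> bool" where
  "restarted_ARE X F Ft L p N x xh \<longleftrightarrow>
     (\<forall>m\<ge>1. ARE_run X F Ft L p N (x m) (xh m) \<and>
             x (Suc m) 1 = ARE_output L p N (x m) (xh m))"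

text \<open>
  For \<open>p = 1\<close> the second factor has exponent \<open>0\<close> and is \<open>1\<close> whatever its base is, whereas
  \<open>0 powr 0 = 0\<close>. The base is \<open>0\<close> if \<open>D0 = 0\<close> or (division by zero) \<open>\<tau> = 1\<close>.
\<close>

definition epoch_length_real :: "nat \<Rightarrow> real \<Rightarrow> real \<Rightarrow> real \<Rightarrow> real \<Rightarrow> real \<Rightarrow> real" where
  "epoch_length_real p \<tau> \<delta> L \<mu> D0 =
     (L / (2 * \<delta> * \<mu>)) powr (2 / (real p + 1)) *
     (if p = 1 then 1 else (D0\<^sup>2 / (1 - \<tau>\<^sup>2)) powr ((real p - 1) / (real p + 1)))"

text \<open>An epoch consists of a positive integer number of iterations, so the real value is rounded up.\<close>

definition epoch_length :: "nat \<Rightarrow> real \<Rightarrow> real \<Rightarrow> real \<Rightarrow> real \<Rightarrow> real \<Rightarrow> nat" where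
  "epoch_length p \<tau> \<delta> L \<mu> D0 = max 1 (nat \<lceil>epoch_length_real p \<tau> \<delta> L \<mu> D0\<rceil>)"

end

theory Submission
  imports Defs
begin

text \<open>
  Summing the extragradient inequality over one epoch that starts at distance \<open>s\<close> from the solution
  bounds both \<open>\<mu> \<Sum>\<^sub>k \<gamma>\<^sub>k\<^sup>-\<^sup>1 \<parallel>x\<^sup>k\<^sup>+\<^sup>0\<^sup>.\<^sup>5 - x\<^sup>*\<parallel>\<^sup>2\<close> and
  \<open>(1 - \<tau>\<^sup>2) / 2 \<Sum>\<^sub>k \<parallel>x\<^sup>k\<^sup>+\<^sup>0\<^sup>.\<^sup>5 - x\<^sup>k\<parallel>\<^sup>2\<close> by \<open>s\<^sup>2 / 2\<close>. By convexity of the squared norm the first bound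
  controls the distance \<open>s'\<close> of the averaged output, and the second one, by a power mean inequality,
  bounds \<open>\<Gamma>\<^sub>N\<close> from below. With the prescribed \<open>N\<close> this gives
  \<open>(s' / D\<^sub>0)\<^sup>2 \<le> \<delta> (s / D\<^sub>0)\<^sup>p\<^sup>+\<^sup>1\<close>. Hence after \<open>m\<close> epochs the squared distance is at most
  \<open>D\<^sub>0\<^sup>2\<close> times \<open>\<delta>\<close> to the power \<open>1 + q + \<dots> + q\<^sup>m\<^sup>-\<^sup>1\<close>, \<open>q = (p + 1) / 2\<close>: superlinear for
  \<open>p > 1\<close> and linear for \<open>p = 1\<close>. For \<open>p = 1\<close>, rounding \<open>N\<close> up is harmless because \<open>\<mu> \<le> L\<close>.
\<close>

section \<open>Optimality conditions and the extragradient inequality\<close>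

lemma linear_coeff_nonneg:
  fixes a b :: real
  assumes "\<And>t. 0 < t \<Longrightarrow> t \<le> 1 \<Longrightarrow> 0 \<le> a * t + b * t\<^sup>2"
  shows "0 \<le> a"
proof (rule tendsto_lowerbound)
  show "((\<lambda>t. a + b * t) \<longlongrightarrow> a) (at_right 0)"
    by (rule tendsto_eq_intros refl | simp)+
  have "0 \<le> a + b * t" if "0 < t" "t < 1" for t
  proof -
    have "0 \<le> t * (a + b * t)"
      using assms[of t] that by (simp add: algebra_simps power2_eq_square)
    then show ?thesis
      using that by (simp add: zero_le_mult_iff)
  qed
  then show "eventually (\<lambda>t. 0 \<le> a + b * t) (at_right 0)"
    by (auto intro!: eventually_at_rightI[of 0 1])
qed simp

text \<open>By convexity, the segment from \<open>y\<close> to \<open>z\<close> stays in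
  \<open>X\<close>. Along it the objective is a quadratic polynomial in the step length
  \<open>t\<close> that is never below its value at \<open>t = 0\<close>, so its linear coefficient,
  the claimed inner product, is nonnegative.\<close>

lemma arg_min_first_order:
  fixes g :: "'a::real_inner"
  assumes "convex X"
    and arg_min: "is_arg_min (\<lambda>z. g \<bullet> (z - x) + c / 2 * (norm (z - x))\<^sup>2) (\<lambda>z. z \<in> X) y"
    and "z \<in> X"
  shows "0 \<le> (g + c *\<^sub>R (y - x)) \<bullet> (z - y)"
proof (rule linear_coeff_nonneg)
  fix t :: real
  assume t: "0 < t" "t \<le> 1"
  have collect: "t * b + c / 2 * (2 * t * a + t\<^sup>2 * d) = (b + c * a) * t + (c / 2 * d) * t\<^sup>2"
    for a b d :: real
    by (simp add: algebra_simps)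
  have y: "y \<in> X"
    using arg_min by (simp add: is_arg_min_def)
  let ?w = "y + t *\<^sub>R (z - y)"
  have "(1 - t) *\<^sub>R y + t *\<^sub>R z \<in> X"
    using assms(1,3) y t by (intro convexD) auto
  moreover have "?w = (1 - t) *\<^sub>R y + t *\<^sub>R z"
    by (simp add: algebra_simps)
  ultimately have "?w \<in> X"
    by simp
  then have "g \<bullet> (y - x) + c / 2 * (norm (y - x))\<^sup>2 \<le> g \<bullet> (?w - x) + c / 2 * (norm (?w - x))\<^sup>2"
    using arg_min by (auto simp: is_arg_min_def not_less)
  moreover have w: "?w - x = (y - x) + t *\<^sub>R (z - y)"
    by simp
  have "(norm (?w - x))\<^sup>2
      = (norm (y - x))\<^sup>2 + 2 * t * ((y - x) \<bullet> (z - y)) + t\<^sup>2 * (norm (z - y))\<^sup>2"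
    unfolding w power2_norm_eq_inner inner_add_left inner_add_right inner_scaleR_left
      inner_scaleR_right
    by (simp add: inner_commute algebra_simps power2_eq_square)
  moreover have "g \<bullet> (?w - x) = g \<bullet> (y - x) + t * (g \<bullet> (z - y))"
    unfolding w by (simp only: inner_add_right inner_scaleR_right)
  ultimately have "0 \<le> t * (g \<bullet> (z - y))
      + c / 2 * (2 * t * ((y - x) \<bullet> (z - y)) + t\<^sup>2 * (norm (z - y))\<^sup>2)"
    by (simp only: distrib_left)
  then show "0 \<le> ((g + c *\<^sub>R (y - x)) \<bullet> (z - y)) * t + (c / 2 * (norm (z - y))\<^sup>2) * t\<^sup>2"
    unfolding inner_add_left inner_scaleR_left collect .
qed

lemma inner_diff_three_points:
  fixes a b z :: "'a::real_inner"
  shows "2 * ((b - a) \<bullet> (z - b)) = (norm (z - a))\<^sup>2 - (norm (z - b))\<^sup>2 - (norm (b - a))\<^sup>2"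
  by (simp add: power2_norm_eq_inner inner_diff_left inner_diff_right inner_commute)

text \<open>Write \<open>g \<bullet> (xh - z)\<close> as \<open>(h - g) \<bullet> (x' - xh) - h
  \<bullet> (x' - xh) - g \<bullet> (z - x')\<close>. The optimality conditions and the three-point
  identity turn the last two terms into differences of squared distances, in which
  \<open>x' - x\<close> cancels. Cauchy-Schwarz and the inequality of arithmetic and geometric means
  bound the first term; the square of \<open>x' - xh\<close> produced there cancels as well.\<close>

lemma extragradient_step:
  fixes g h x x' xh z :: "'a::real_inner"
  assumes half: "0 \<le> (h + c *\<^sub>R (xh - x)) \<bullet> (x' - xh)"
    and full: "0 \<le> (g + c *\<^sub>R (x' - x)) \<bullet> (z - x')"
    and approx: "norm (h - g) \<le> \<tau> * c * norm (xh - x)"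
    and "0 \<le> c"
  shows "g \<bullet> (xh - z) \<le>
    c / 2 * ((norm (z - x))\<^sup>2 - (norm (z - x'))\<^sup>2 - (1 - \<tau>\<^sup>2) * (norm (xh - x))\<^sup>2)"
proof -
  let ?a = "norm (xh - x)" and ?b = "norm (x' - xh)"
  have "(h - g) \<bullet> (x' - xh) \<le> norm (h - g) * ?b"
    by (rule norm_cauchy_schwarz)
  also have "\<dots> \<le> \<tau> * c * ?a * ?b"
    using approx by (intro mult_right_mono) auto
  also have "\<dots> = c / 2 * (2 * (\<tau> * ?a) * ?b)"
    by simp
  also have "\<dots> \<le> c / 2 * (\<tau>\<^sup>2 * ?a\<^sup>2 + ?b\<^sup>2)"
    using \<open>0 \<le> c\<close> sum_squares_bound[of "\<tau> * ?a" ?b]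
    by (intro mult_left_mono) (auto simp: power_mult_distrib)
  finally have err: "(h - g) \<bullet> (x' - xh) \<le> c / 2 * (\<tau>\<^sup>2 * ?a\<^sup>2 + ?b\<^sup>2)" .
  have "c * (2 * ((x' - x) \<bullet> (z - x')))
      = c * ((norm (z - x))\<^sup>2 - (norm (z - x'))\<^sup>2 - (norm (x' - x))\<^sup>2)"
    "c * (2 * ((xh - x) \<bullet> (x' - xh))) = c * ((norm (x' - x))\<^sup>2 - ?b\<^sup>2 - ?a\<^sup>2)"
    by (simp_all only: inner_diff_three_points)
  moreover have "g \<bullet> (xh - z) = (h - g) \<bullet> (x' - xh) - h \<bullet> (x' - xh) - g \<bullet> (z - x')"
    by (simp add: inner_diff_left inner_diff_right)
  ultimately show ?thesis
    using err half full by (simp add: inner_add_left algebra_simps)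
qed

section \<open>Weighted means and a power mean inequality\<close>

text \<open>Jensen's inequality for the squared norm: with \<open>v\<close> the deviation of the
  weighted mean from \<open>c\<close>, the difference of the two sides is the weighted variance of
  the \<open>u k\<close>.\<close>

lemma norm_weighted_mean_le:
  fixes u :: "'b \<Rightarrow> 'a::real_inner"
  assumes "\<And>k. k \<in> A \<Longrightarrow> 0 \<le> w k" and W: "0 < sum w A"
  shows "sum w A * (norm ((1 / sum w A) *\<^sub>R (\<Sum>k\<in>A. w k *\<^sub>R u k) - c))\<^sup>2
    \<le> (\<Sum>k\<in>A. w k * (norm (u k - c))\<^sup>2)"
proof -
  define v where "v = (1 / sum w A) *\<^sub>R (\<Sum>k\<in>A. w k *\<^sub>R u k) - c"
  have "sum w A *\<^sub>R v = (\<Sum>k\<in>A. w k *\<^sub>R (u k - c))"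
    using W by (simp add: v_def scaleR_diff_right sum_subtractf flip: scaleR_left.sum)
  then have "sum w A * (v \<bullet> v) = (\<Sum>k\<in>A. w k *\<^sub>R (u k - c)) \<bullet> v"
    by (metis inner_scaleR_left)
  then have v: "(\<Sum>k\<in>A. w k * ((u k - c) \<bullet> v)) = sum w A * (v \<bullet> v)"
    by (simp add: inner_sum_left)
  have "0 \<le> (\<Sum>k\<in>A. w k * (norm ((u k - c) - v))\<^sup>2)"
    using assms(1) by (intro sum_nonneg) auto
  also have "\<dots> = (\<Sum>k\<in>A. w k * (norm (u k - c))\<^sup>2 - 2 * (w k * ((u k - c) \<bullet> v)) + w k * (v \<bullet> v))"
    by (intro sum.cong refl)
      (simp add: power2_norm_eq_inner inner_diff_left inner_diff_right inner_commute algebra_simps)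
  also have "\<dots> = (\<Sum>k\<in>A. w k * (norm (u k - c))\<^sup>2) - sum w A * (v \<bullet> v)"
    unfolding sum.distrib sum_subtractf sum_distrib_left[symmetric] sum_distrib_right[symmetric] v
    by simp
  finally show ?thesis
    by (simp add: v_def power2_norm_eq_inner)
qed

text \<open>As a function of \<open>a\<^sup>2\<close>, the right-hand side is convex; the left-hand side is its tangent at 1.\<close>

lemma inverse_power_tangent:
  fixes a :: real
  assumes "0 < a"
  shows "1 - real q / 2 * (a\<^sup>2 - 1) \<le> 1 / a ^ q"
proof -
  \<comment> \<open>Two tangent inequalities are chained:
    \<open>1 / a ^ q = exp (- q * ln a)\<close> is at least \<open>1 - q * ln a\<close>, and
    \<open>ln a\<close> is at most \<open>(a\<^sup>2 - 1) / 2\<close>.\<close>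
  have "2 * ln a \<le> a\<^sup>2 - 1"
    using ln_le_minus_one[of "a\<^sup>2"] assms by (simp add: ln_realpow)
  then have "real q * ln a \<le> real q * ((a\<^sup>2 - 1) / 2)"
    by (intro mult_left_mono) auto
  moreover have "1 + (- real q * ln a) \<le> exp (- real q * ln a)"
    by (rule exp_ge_add_one_self)
  moreover have "exp (- real q * ln a) = 1 / a ^ q"
    using assms by (simp add: exp_minus exp_of_nat_mult divide_inverse)
  ultimately show ?thesis
    by simp
qed

text \<open>After rescaling by \<open>r\<close>, the mean of the squares is at most 1. Summing the
  tangent inequality over \<open>A\<close> then leaves a linear term that only helps.\<close>

lemma sum_inverse_power_ge:
  fixes a :: "'b \<Rightarrow> real"
  assumes pos: "\<And>k. k \<in> A \<Longrightarrow> 0 < a k" and "0 < r"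
    and r: "(\<Sum>k\<in>A. (a k)\<^sup>2) \<le> real (card A) * r\<^sup>2"
  shows "real (card A) \<le> r ^ q * (\<Sum>k\<in>A. 1 / a k ^ q)"
proof -
  have "(\<Sum>k\<in>A. 1 - real q / 2 * ((a k / r)\<^sup>2 - 1)) \<le> (\<Sum>k\<in>A. 1 / (a k / r) ^ q)"
    using assms by (intro sum_mono inverse_power_tangent) auto
  moreover have "(\<Sum>k\<in>A. 1 - real q / 2 * ((a k / r)\<^sup>2 - 1))
      = real (card A) - real q / 2 * ((\<Sum>k\<in>A. (a k)\<^sup>2) / r\<^sup>2 - real (card A))"
    by (simp add: sum_subtractf power_divide flip: sum_distrib_left sum_divide_distrib)
  moreover have "real q / 2 * ((\<Sum>k\<in>A. (a k)\<^sup>2) / r\<^sup>2 - real (card A)) \<le> 0"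
    using r \<open>0 < r\<close> by (intro mult_nonneg_nonpos) (auto simp: field_simps)
  moreover have "(\<Sum>k\<in>A. 1 / (a k / r) ^ q) = r ^ q * (\<Sum>k\<in>A. 1 / a k ^ q)"
    by (simp add: power_divide sum_distrib_left)
  ultimately show ?thesis
    by linarith
qed

section \<open>One epoch of ARE\<close>

lemma VI_unique:
  assumes "strongly_monotone_on X \<mu> F" "x \<in> VI X F" "y \<in> VI X F"
  shows "x = y"
proof -
  have "0 \<le> F x \<bullet> (y - x)" "0 \<le> F y \<bullet> (x - y)"
    using assms(2,3) by (auto simp: VI_def)
  then have "(F x - F y) \<bullet> (x - y) \<le> 0"
    by (simp add: inner_diff_left inner_diff_right)
  moreover have "\<mu> * (norm (x - y))\<^sup>2 \<le> (F x - F y) \<bullet> (x - y)" "0 < \<mu>"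
    using assms by (auto simp: strongly_monotone_on_def VI_def)
  ultimately have "\<mu> * (norm (x - y))\<^sup>2 \<le> 0"
    by simp
  then show ?thesis
    using \<open>0 < \<mu>\<close> by (simp add: mult_le_0_iff)
qed

lemma ARE_run_mem:
  assumes "ARE_run X F Ft L p N x xh" "k \<in> {1..Suc N}"
  shows "x k \<in> X"
proof (cases "k = 1")
  case False
  then obtain j where "k = Suc j" "j \<in> {1..N}"
    using assms(2) by (cases k) auto
  then show ?thesis
    using assms(1) by (auto simp: ARE_run_def is_arg_min_def)
qed (use assms in \<open>simp add: ARE_run_def\<close>)

lemma ARE_half_step_mem:
  assumes "ARE_run X F Ft L p N x xh" "k \<in> {1..N}"
  shows "xh k \<in> X"
  using assms by (auto simp: ARE_run_def VI_def)

text \<open>A vanishing \<open>\<gamma>\<close> forces \<open>p > 1\<close> and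
  \<open>xh k = x k\<close>. There the regularization is zero and the approximation is exact, so the
  subproblem's inequality is that of \<open>F\<close>. This justifies the special case in
  \<open>ARE_output\<close>.\<close>

lemma ARE_gamma_eq_0_solves:
  assumes run: "ARE_run X F Ft L p N x xh" and k: "k \<in> {1..N}"
    and approx: "\<And>z. z \<in> X \<Longrightarrow> norm (Ft z (x k) - F z) \<le> \<tau> * L * norm (z - x k) ^ p"
    and "0 < L" and 0: "ARE_gamma L p x xh k = 0"
  shows "xh k \<in> VI X F"
proof -
  have x: "xh k = x k" and p: "p > 1"
    using 0 \<open>0 < L\<close> by (auto simp: ARE_gamma_def)
  have VI: "xh k \<in> VI X (\<lambda>z. Ft z (x k) + (L * norm (z - x k) ^ (p - 1)) *\<^sub>R (z - x k))"
    using run k by (simp add: ARE_run_def)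
  then have "xh k \<in> X"
    by (simp add: VI_def)
  from approx[OF this] have "Ft (xh k) (x k) = F (xh k)"
    using p x by (simp add: zero_power)
  with VI show ?thesis
    by (simp add: VI_def x)
qed

text \<open>This is \<open>extragradient_step\<close> with \<open>z = xstar\<close> and
  \<open>c\<close> the current \<open>\<gamma>\<close>: splitting one factor off the
  \<open>p\<close>-th power turns the approximation bound into \<open>\<tau>\<close> times
  \<open>\<gamma>\<close> times the step length. Strong monotonicity and the inequality solved by
  \<open>xstar\<close> bound the left-hand side.\<close>

lemma ARE_step:
  assumes "convex X" and "p \<ge> 1" and "0 \<le> L"
    and mono: "strongly_monotone_on X \<mu> F" and xstar: "xstar \<in> VI X F"
    and run: "ARE_run X F Ft L p N x xh" and k: "k \<in> {1..N}"
    and approx: "\<And>z. z \<in> X \<Longrightarrow> norm (Ft z (x k) - F z) \<le> \<tau> * L * norm (z - x k) ^ p"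
  shows "\<mu> * (norm (xh k - xstar))\<^sup>2 \<le> ARE_gamma L p x xh k / 2 *
    ((norm (x k - xstar))\<^sup>2 - (norm (x (Suc k) - xstar))\<^sup>2 - (1 - \<tau>\<^sup>2) * (norm (xh k - x k))\<^sup>2)"
proof -
  have xh: "xh k \<in> X" and x': "x (Suc k) \<in> X"
    using ARE_half_step_mem[OF run k] ARE_run_mem[OF run, of "Suc k"] k by auto
  have xs: "xstar \<in> X" "0 \<le> F xstar \<bullet> (xh k - xstar)"
    using xstar xh by (auto simp: VI_def)
  have "norm (xh k - x k) ^ p = norm (xh k - x k) ^ (p - 1) * norm (xh k - x k)"
    using \<open>p \<ge> 1\<close> by (metis Suc_diff_1 less_le_trans power_Suc2 zero_less_one)
  then have approx': "norm (Ft (xh k) (x k) - F (xh k))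
      \<le> \<tau> * ARE_gamma L p x xh k * norm (xh k - x k)"
    using approx[OF xh] by (simp add: ARE_gamma_def mult.assoc)
  have "F (xh k) \<bullet> (xh k - xstar) \<le> ARE_gamma L p x xh k / 2 *
    ((norm (xstar - x k))\<^sup>2 - (norm (xstar - x (Suc k)))\<^sup>2 - (1 - \<tau>\<^sup>2) * (norm (xh k - x k))\<^sup>2)"
  proof (rule extragradient_step[OF _ _ approx'])
    show "0 \<le> (Ft (xh k) (x k) + ARE_gamma L p x xh k *\<^sub>R (xh k - x k)) \<bullet> (x (Suc k) - xh k)"
      using run k x' by (auto simp: ARE_run_def VI_def ARE_gamma_def)
    show "0 \<le> (F (xh k) + ARE_gamma L p x xh k *\<^sub>R (x (Suc k) - x k)) \<bullet> (xstar - x (Suc k))"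
      using run k xs by (intro arg_min_first_order[OF \<open>convex X\<close>]) (auto simp: ARE_run_def)
    show "0 \<le> ARE_gamma L p x xh k"
      using \<open>0 \<le> L\<close> by (simp add: ARE_gamma_def)
  qed
  moreover have "\<mu> * (norm (xh k - xstar))\<^sup>2 \<le> (F (xh k) - F xstar) \<bullet> (xh k - xstar)"
    using mono xh xs by (auto simp: strongly_monotone_on_def)
  ultimately show ?thesis
    using xs by (simp add: inner_diff_left norm_minus_commute)
qed

text \<open>
  Multiplied out, the estimate remains valid for \<open>p = 1\<close>, \<open>\<tau> = 1\<close> and for a start at the solution,
  where the quotient form would divide by zero.
\<close>

lemma ARE_epoch:
  fixes x xh :: "nat \<Rightarrow> 'a::real_inner"
  assumes "convex X" and "p \<ge> 1" and "0 < L" and "0 < \<tau>" "\<tau> \<le> 1" and \<tau>: "p = 1 \<or> \<tau> < 1"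
    and mono: "strongly_monotone_on X \<mu> F" and xstar: "xstar \<in> VI X F" and "N \<ge> 1"
    and run: "ARE_run X F Ft L p N x xh"
    and approx: "\<And>k z. k \<in> {1..N} \<Longrightarrow> z \<in> X \<Longrightarrow>
      norm (Ft z (x k) - F z) \<le> \<tau> * L * norm (z - x k) ^ p"
  shows "2 * \<mu> * (norm (ARE_output L p N x xh - xstar))\<^sup>2 * real N *
      (sqrt (1 - \<tau>\<^sup>2) * sqrt (real N)) ^ (p - 1)
    \<le> L * (norm (x 1 - xstar))\<^sup>2 * norm (x 1 - xstar) ^ (p - 1)"
proof (cases "\<exists>k\<in>{1..N}. ARE_gamma L p x xh k = 0")
  case True
  \<comment> \<open>The output is the solution itself in this case, so the left-hand side of the
    claim is 0.\<close>
  let ?k = "LEAST k. k \<in> {1..N} \<and> ARE_gamma L p x xh k = 0"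
  have k: "?k \<in> {1..N} \<and> ARE_gamma L p x xh ?k = 0"
    using True LeastI_ex[of "\<lambda>k. k \<in> {1..N} \<and> ARE_gamma L p x xh k = 0"] by blast
  have "xh ?k \<in> VI X F"
    by (rule ARE_gamma_eq_0_solves[OF run _ approx \<open>0 < L\<close>]) (use k in auto)
  then have "xh ?k = xstar"
    using VI_unique[OF mono] xstar by blast
  then have "ARE_output L p N x xh = xstar"
    using True by (simp add: ARE_output_def)
  then show ?thesis
    using \<open>0 < L\<close> by simp
next
  case False
  define a where "a k = norm (xh k - x k)" for k
  define \<gamma> where "\<gamma> = ARE_gamma L p x xh"
  define s where "s = norm (x 1 - xstar)"
  define out where "out = norm (ARE_output L p N x xh - xstar)"
  define S where "S = (\<Sum>k=1..N. 1 / \<gamma> k)"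
  have "0 < \<mu>"
    using mono by (simp add: strongly_monotone_on_def)
  have \<gamma>: "\<gamma> k = L * a k ^ (p - 1)" for k
    by (simp add: \<gamma>_def ARE_gamma_def a_def)
  have \<gamma>_pos: "0 < \<gamma> k" if "k \<in> {1..N}" for k
  proof -
    have "0 \<le> \<gamma> k"
      using \<open>0 < L\<close> by (simp add: \<gamma> a_def)
    moreover have "\<gamma> k \<noteq> 0"
      using False that by (auto simp: \<gamma>_def)
    ultimately show ?thesis by simp
  qed
  have S_pos: "0 < S"
    unfolding S_def using \<gamma>_pos \<open>N \<ge> 1\<close> by (intro sum_pos) auto
  \<comment> \<open>Dividing by \<open>\<gamma> k\<close> removes the weight from the differences of
    squared distances, which then telescope. This is where the weights of the averaged output come
    from.\<close>
  have "2 * \<mu> * (1 / \<gamma> k * (norm (xh k - xstar))\<^sup>2) + (1 - \<tau>\<^sup>2) * (a k)\<^sup>2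
      \<le> (norm (x k - xstar))\<^sup>2 - (norm (x (Suc k) - xstar))\<^sup>2" if "k \<in> {1..N}" for k
  proof -
    have "\<mu> * (norm (xh k - xstar))\<^sup>2 \<le> \<gamma> k / 2 * ((norm (x k - xstar))\<^sup>2 -
        (norm (x (Suc k) - xstar))\<^sup>2 - (1 - \<tau>\<^sup>2) * (a k)\<^sup>2)"
      using ARE_step[OF \<open>convex X\<close> \<open>p \<ge> 1\<close> _ mono xstar run that, of \<tau>] approx[OF that] \<open>0 < L\<close>
      by (simp add: \<gamma>_def a_def)
    then show ?thesis
      using \<gamma>_pos[OF that] by (simp add: field_simps)
  qed
  then have "(\<Sum>k=1..N. 2 * \<mu> * (1 / \<gamma> k * (norm (xh k - xstar))\<^sup>2) + (1 - \<tau>\<^sup>2) * (a k)\<^sup>2)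
      \<le> (\<Sum>k=1..N. (norm (x k - xstar))\<^sup>2 - (norm (x (Suc k) - xstar))\<^sup>2)"
    by (rule sum_mono)
  also have "\<dots> = s\<^sup>2 - (norm (x (Suc N) - xstar))\<^sup>2"
    using sum_Suc_diff[of 1 N "\<lambda>k. - (norm (x k - xstar))\<^sup>2"] \<open>N \<ge> 1\<close>
    by (simp add: s_def)
  also have "\<dots> \<le> s\<^sup>2"
    by simp
  finally have total: "2 * \<mu> * (\<Sum>k=1..N. 1 / \<gamma> k * (norm (xh k - xstar))\<^sup>2)
      + (1 - \<tau>\<^sup>2) * (\<Sum>k=1..N. (a k)\<^sup>2) \<le> s\<^sup>2"
    by (simp add: sum.distrib sum_distrib_left)
  have \<tau>_sq: "\<tau>\<^sup>2 \<le> 1"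
    using \<open>0 < \<tau>\<close> \<open>\<tau> \<le> 1\<close> by (simp add: power_le_one)
  have "ARE_output L p N x xh = (1 / S) *\<^sub>R (\<Sum>k=1..N. (1 / \<gamma> k) *\<^sub>R xh k)"
    using False by (simp add: ARE_output_def S_def \<gamma>_def)
  then have "S * out\<^sup>2 \<le> (\<Sum>k=1..N. 1 / \<gamma> k * (norm (xh k - xstar))\<^sup>2)"
    using norm_weighted_mean_le[of "{1..N}" "\<lambda>k. 1 / \<gamma> k" xh xstar] \<gamma>_pos S_pos
    by (simp add: S_def out_def less_imp_le)
  then have "2 * \<mu> * (S * out\<^sup>2) \<le> 2 * \<mu> * (\<Sum>k=1..N. 1 / \<gamma> k * (norm (xh k - xstar))\<^sup>2)"
    using \<open>0 < \<mu>\<close> by (intro mult_left_mono) auto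
  also have "\<dots> \<le> s\<^sup>2"
    using total \<tau>_sq
    by (smt (verit) mult_nonneg_nonneg sum_nonneg zero_le_power2)
  finally have out: "2 * \<mu> * (S * out\<^sup>2) \<le> s\<^sup>2" .
  have LS: "L * S = (\<Sum>k=1..N. 1 / a k ^ (p - 1))"
    using \<open>0 < L\<close> by (simp add: S_def \<gamma> sum_distrib_left)
  have key: "real N * (sqrt (1 - \<tau>\<^sup>2) * sqrt (real N)) ^ (p - 1) \<le> s ^ (p - 1) * (L * S)"
  proof (cases "p = 1")
    case True
    then show ?thesis
      by (simp add: LS)
  next
    case False
    then have "\<tau> < 1" and p: "p > 1"
      using \<tau> \<open>p \<ge> 1\<close> by auto
    then have \<tau>_sq: "\<tau>\<^sup>2 < 1"
      using \<open>0 < \<tau>\<close> by (simp add: power_less_one_iff)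
    have a_pos: "0 < a k" if "k \<in> {1..N}" for k
      using \<gamma>_pos[OF that] p \<open>0 < L\<close> by (auto simp: \<gamma> a_def zero_less_mult_iff zero_power)
    \<comment> \<open>The scale for the power mean is \<open>s / v\<close>: by \<open>a_le\<close>
      below, the mean of the \<open>(a k)\<^sup>2\<close> is at most
      \<open>(s / v)\<^sup>2\<close>.\<close>
    define v where "v = sqrt (1 - \<tau>\<^sup>2) * sqrt (real N)"
    have v: "0 < v" "v\<^sup>2 = (1 - \<tau>\<^sup>2) * real N"
      using \<tau>_sq \<open>N \<ge> 1\<close> by (auto simp: v_def power_mult_distrib)
    \<comment> \<open>Here the first sum of \<open>total\<close> is dropped; the bound
      \<open>out\<close> came from dropping the second.\<close>
    have "0 \<le> 2 * \<mu> * (\<Sum>k=1..N. 1 / \<gamma> k * (norm (xh k - xstar))\<^sup>2)"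
      using \<open>0 < \<mu>\<close> \<gamma>_pos by (intro mult_nonneg_nonneg sum_nonneg) (auto simp: less_imp_le)
    with total have a_le: "(1 - \<tau>\<^sup>2) * (\<Sum>k=1..N. (a k)\<^sup>2) \<le> s\<^sup>2"
      by linarith
    have "0 < (\<Sum>k=1..N. (a k)\<^sup>2)"
      using a_pos \<open>N \<ge> 1\<close> by (intro sum_pos) (auto simp: less_imp_neq[symmetric])
    then have "0 < (1 - \<tau>\<^sup>2) * (\<Sum>k=1..N. (a k)\<^sup>2)"
      using \<tau>_sq by simp
    with a_le have "0 < s\<^sup>2"
      by linarith
    then have s: "0 < s"
      by (simp add: s_def)
    have "real (card {1..N}) \<le> (s / v) ^ (p - 1) * (\<Sum>k=1..N. 1 / a k ^ (p - 1))"
    proof (rule sum_inverse_power_ge[OF a_pos])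
      show "(\<Sum>k=1..N. (a k)\<^sup>2) \<le> real (card {1..N}) * (s / v)\<^sup>2"
        using a_le \<tau>_sq \<open>N \<ge> 1\<close> by (simp add: power_divide v pos_le_divide_eq mult.commute)
    qed (use s v in auto)
    then show ?thesis
      using v(1) unfolding LS v_def[symmetric] by (simp add: power_divide field_simps)
  qed
  have "2 * \<mu> * out\<^sup>2 * (real N * (sqrt (1 - \<tau>\<^sup>2) * sqrt (real N)) ^ (p - 1))
      \<le> 2 * \<mu> * out\<^sup>2 * (s ^ (p - 1) * (L * S))"
    using key \<open>0 < \<mu>\<close> by (intro mult_left_mono) auto
  also have "\<dots> = (2 * \<mu> * (S * out\<^sup>2)) * (L * s ^ (p - 1))"
    by simp
  also have "\<dots> \<le> s\<^sup>2 * (L * s ^ (p - 1))"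
    using out \<open>0 < L\<close> by (intro mult_right_mono) (auto simp: s_def)
  finally show ?thesis
    by (simp add: s_def out_def mult_ac)
qed

section \<open>The epoch length from below\<close>

lemma epoch_length_real_le:
  "epoch_length_real p \<tau> \<delta> L \<mu> D0 \<le> real (epoch_length p \<tau> \<delta> L \<mu> D0)"
  unfolding epoch_length_def by linarith

lemma epoch_length_ge_1: "1 \<le> epoch_length p \<tau> \<delta> L \<mu> D0"
  by (simp add: epoch_length_def)

text \<open>For \<open>p > 1\<close>, raising the defining formula to the power
  \<open>(p + 1) / 2\<close> clears its fractional exponents. The result is stated with the same
  factor of \<open>N\<close> and \<open>\<tau>\<close> as \<open>ARE_epoch\<close>, so that this
  factor can be eliminated between the two.\<close>

lemma epoch_length_lower_bound:
  assumes "p \<ge> 1" "0 < \<tau>" "\<tau> \<le> 1" "p = 1 \<or> \<tau> < 1" "0 < \<delta>" "0 < L" "0 < \<mu>" "0 \<le> D0"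
    and N: "N = epoch_length p \<tau> \<delta> L \<mu> D0"
  shows "L * D0 ^ (p - 1) \<le> 2 * \<delta> * \<mu> * real N * (sqrt (1 - \<tau>\<^sup>2) * sqrt (real N)) ^ (p - 1)"
proof (cases "p = 1")
  case True
  have "L / (2 * \<delta> * \<mu>) \<le> real N"
    using epoch_length_real_le[of p \<tau> \<delta> L \<mu> D0] assms True by (simp add: epoch_length_real_def)
  then show ?thesis
    using True assms by (simp add: field_simps)
next
  case False
  then have "\<tau> < 1" and p: "p > 1"
    using assms by auto
  then have \<tau>_sq: "\<tau>\<^sup>2 < 1"
    using \<open>0 < \<tau>\<close> by (simp add: power_less_one_iff)
  have N1: "1 \<le> N"
    using epoch_length_ge_1 N by simp
  show ?thesis
  proof (cases "D0 = 0")
    case True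
    then show ?thesis
      using p assms \<tau>_sq by (simp add: zero_power)
  next
    case False
    define v where "v = sqrt (1 - \<tau>\<^sup>2)"
    have v: "0 < v" "1 - \<tau>\<^sup>2 = v\<^sup>2"
      using \<tau>_sq by (auto simp: v_def)
    define c where "c = L / (2 * \<delta> * \<mu>)"
    have "0 < c" "0 < D0"
      using assms False by (auto simp: c_def)
    \<comment> \<open>Translates the real exponent \<open>(p - 1) / 2\<close> into the natural
      exponent \<open>p - 1\<close>.\<close>
    have half_powr: "(t\<^sup>2) powr ((real p - 1) / 2) = t ^ (p - 1)" if "0 < t" for t
    proof -
      have "t\<^sup>2 = t powr 2"
        using that by (simp add: powr_numeral)
      then have "(t\<^sup>2) powr ((real p - 1) / 2) = t powr real (p - 1)"
        using p by (simp add: powr_powr of_nat_diff diff_divide_distrib)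
      then show ?thesis
        using that by (simp add: powr_realpow)
    qed
    have "c powr (2 / (real p + 1)) * (D0\<^sup>2 / v\<^sup>2) powr ((real p - 1) / (real p + 1)) \<le> real N"
      using epoch_length_real_le[of p \<tau> \<delta> L \<mu> D0] p v
      by (simp add: epoch_length_real_def c_def N)
    then have "(c powr (2 / (real p + 1)) * (D0\<^sup>2 / v\<^sup>2) powr ((real p - 1) / (real p + 1)))
        powr ((real p + 1) / 2) \<le> real N powr ((real p + 1) / 2)"
      by (intro powr_mono2) auto
    also have "(c powr (2 / (real p + 1)) * (D0\<^sup>2 / v\<^sup>2) powr ((real p - 1) / (real p + 1)))
        powr ((real p + 1) / 2) = c * ((D0 / v)\<^sup>2) powr ((real p - 1) / 2)"
    proof -
      have "2 / (real p + 1) * ((real p + 1) / 2) = 1"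
        "(real p - 1) / (real p + 1) * ((real p + 1) / 2) = (real p - 1) / 2"
        by (simp_all add: field_simps)
      then show ?thesis
        using \<open>0 < c\<close> by (simp only: powr_mult powr_powr power_divide powr_one)
    qed
    also have "\<dots> = c * (D0 / v) ^ (p - 1)"
      using \<open>0 < D0\<close> v by (subst half_powr) auto
    also have "real N powr ((real p + 1) / 2) = real N powr (1 + (real p - 1) / 2)"
      by (simp add: field_simps)
    also have "\<dots> = real N * ((sqrt (real N))\<^sup>2) powr ((real p - 1) / 2)"
      using N1 by (simp add: powr_add)
    also have "\<dots> = real N * sqrt (real N) ^ (p - 1)"
      using N1 by (subst half_powr) auto
    finally have "c * D0 ^ (p - 1) \<le> real N * (v * sqrt (real N)) ^ (p - 1)"
      using v(1) by (simp add: power_divide power_mult_distrib field_simps)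
    then show ?thesis
      using assms by (simp add: c_def v_def field_simps)
  qed
qed

section \<open>Solving the recursion and counting epochs\<close>

text \<open>The ratios \<open>t m = s m / s 1\<close> satisfy
  \<open>(t (Suc m))\<^sup>2 \<le> \<delta> * t m ^ (p + 1)\<close>, so the exponent of
  \<open>\<delta>\<close> evolves by \<open>A \<mapsto> 1 + q * A\<close> with
  \<open>q = (p + 1) / 2\<close>, which generates the geometric sum. The hypothesis
  \<open>zero\<close> covers \<open>s 1 = 0\<close>, where \<open>rec\<close> is void for
  \<open>p > 1\<close>.\<close>

lemma superlinear_recursion:
  fixes s :: "nat \<Rightarrow> real"
  assumes "p \<ge> 1" "0 < \<delta>"
    and nonneg: "\<And>m. 0 \<le> s m"
    and rec: "\<And>m. m \<ge> 1 \<Longrightarrow> (s (Suc m))\<^sup>2 * s 1 ^ (p - 1) \<le> \<delta> * ((s m)\<^sup>2 * s m ^ (p - 1))"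
    and zero: "\<And>m. m \<ge> 1 \<Longrightarrow> s m = 0 \<Longrightarrow> s (Suc m) = 0"
    and "m \<ge> 1"
  shows "(s (Suc m))\<^sup>2 \<le> (s 1)\<^sup>2 * \<delta> powr (\<Sum>i<m. ((real p + 1) / 2) ^ i)"
proof (cases "s 1 = 0")
  case True
  have "s (Suc m) = 0" for m
    by (induction m) (use True zero in auto)
  then show ?thesis
    by simp
next
  case False
  then have D: "0 < s 1"
    using nonneg[of 1] by simp
  define t where "t m = s m / s 1" for m
  have t_nonneg: "0 \<le> t m" for m
    using nonneg D by (simp add: t_def)
  have t_rec: "(t (Suc m))\<^sup>2 \<le> \<delta> * t m ^ (p + 1)" if "m \<ge> 1" for m
  proof -
    have split: "z ^ (p + 1) = z\<^sup>2 * z ^ (p - 1)" for z :: real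
      using \<open>p \<ge> 1\<close> by (simp flip: power_add)
    have "(t (Suc m))\<^sup>2 = (s (Suc m))\<^sup>2 * s 1 ^ (p - 1) / s 1 ^ (p + 1)"
      using D unfolding split by (simp add: t_def power_divide)
    also have "\<dots> \<le> \<delta> * ((s m)\<^sup>2 * s m ^ (p - 1)) / s 1 ^ (p + 1)"
      using rec[OF that] D by (intro divide_right_mono) auto
    also have "\<dots> = \<delta> * t m ^ (p + 1)"
      unfolding t_def power_divide split[symmetric] by simp
    finally show ?thesis .
  qed
  let ?q = "(real p + 1) / 2"
  have "(t (Suc m))\<^sup>2 \<le> \<delta> powr (\<Sum>i<m. ?q ^ i)"
    using \<open>m \<ge> 1\<close>
  proof (induction m rule: dec_induct)
    case base
    have "t 1 = 1"
      using D by (simp add: t_def)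
    then show ?case
      using t_rec[of 1] \<open>0 < \<delta>\<close> by simp
  next
    case (step m)
    let ?A = "\<Sum>i<m. ?q ^ i"
    \<comment> \<open>Taking a square root and then the power \<open>p + 1\<close> multiplies the
      exponent \<open>?A\<close> by \<open>?q\<close>.\<close>
    have "(t (Suc m))\<^sup>2 \<le> (\<delta> powr (?A / 2))\<^sup>2"
      using step.IH \<open>0 < \<delta>\<close> by (simp add: power2_eq_square flip: powr_add)
    then have "t (Suc m) \<le> \<delta> powr (?A / 2)"
      by (rule power2_le_imp_le) simp
    then have "t (Suc m) ^ (p + 1) \<le> (\<delta> powr (?A / 2)) ^ (p + 1)"
      using t_nonneg by (intro power_mono)
    also have "\<dots> = \<delta> powr (?q * ?A)"
      using \<open>0 < \<delta>\<close> by (subst powr_power) (auto simp: algebra_simps)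
    finally have "\<delta> * t (Suc m) ^ (p + 1) \<le> \<delta> * \<delta> powr (?q * ?A)"
      using \<open>0 < \<delta>\<close> by simp
    also have "\<dots> = \<delta> powr (1 + ?q * ?A)"
      using \<open>0 < \<delta>\<close> by (simp add: powr_add)
    also have "1 + ?q * ?A = (\<Sum>i<Suc m. ?q ^ i)"
      unfolding sum.lessThan_Suc_shift by (simp add: sum_distrib_left)
    finally show ?case
      using t_rec[of "Suc m"] by simp
  qed
  then have "(s 1)\<^sup>2 * (t (Suc m))\<^sup>2 \<le> (s 1)\<^sup>2 * \<delta> powr (\<Sum>i<m. ?q ^ i)"
    by (intro mult_left_mono) auto
  then show ?thesis
    using D by (simp add: t_def power_divide)
qed

text \<open>With \<open>\<delta> = 2 powr (- l)\<close>, it suffices that the geometric sum reaches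
  \<open>log 2 r / l\<close>. For \<open>p = 1\<close> the sum is \<open>m\<close>; for
  \<open>p > 1\<close> its largest term alone is enough, whence the iterated logarithm. The
  threshold on \<open>r\<close> makes the relevant logarithm at least 1, so that additive constants
  can be absorbed into \<open>C\<close>.\<close>

lemma epochs_needed:
  assumes "p \<ge> 1" "0 < \<delta>" "\<delta> < 1"
  obtains C where "C > 0" "\<And>r. r \<ge> 2 powr ((real p + 1) / 2) \<Longrightarrow>
    \<exists>m\<ge>1. r * \<delta> powr (\<Sum>i<m. ((real p + 1) / 2) ^ i) \<le> 1 \<and>
      real m \<le> C * (if p = 1 then log 2 r else log ((real p + 1) / 2) (log 2 r))"
proof -
  define q where "q = (real p + 1) / 2"
  define l where "l = - log 2 \<delta>"
  have l: "0 < l" "\<delta> = 2 powr (- l)"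
    using assms by (auto simp: l_def)
  have suff: "r * \<delta> powr a \<le> 1" if "r > 0" "log 2 r / l \<le> a" for r a
  proof -
    have "r * \<delta> powr a = 2 powr (log 2 r) * 2 powr (- l * a)"
      using that l by (simp add: powr_powr)
    also have "\<dots> = 2 powr (log 2 r - l * a)"
      by (simp flip: powr_add)
    also have "\<dots> \<le> 2 powr 0"
      using that l(1) by (intro powr_mono) (auto simp: field_simps)
    finally show ?thesis by simp
  qed
  have \<Lambda>: "0 < r \<and> q \<le> log 2 r" if "r \<ge> 2 powr q" for r
  proof -
    have "0 < r"
      using that by (smt (verit) powr_gt_zero)
    then show ?thesis
      using that by (simp add: le_log_iff)
  qed
  show ?thesis
  proof (cases "p = 1")
    case True
    show ?thesis
    proof (rule that)
      \<comment> \<open>The summand 1 pays for rounding up, as \<open>log 2 r\<close> is at least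
        1.\<close>
      show "0 < 1 / l + 1"
        using l by (simp add: add_pos_pos)
      fix r :: real
      assume "r \<ge> 2 powr ((real p + 1) / 2)"
      then have r: "0 < r" "1 \<le> log 2 r"
        using \<Lambda>[of r] True by (auto simp: q_def)
      define m where "m = nat \<lceil>log 2 r / l\<rceil>"
      have "0 < log 2 r / l"
        using r l by simp
      then have m: "1 \<le> m" "log 2 r / l \<le> real m" "real m \<le> log 2 r / l + 1"
        unfolding m_def by linarith+
      have "r * \<delta> powr (\<Sum>i<m. ((real p + 1) / 2) ^ i) \<le> 1"
        using suff[OF r(1) m(2)] True by simp
      moreover have "real m \<le> (1 / l + 1) * log 2 r"
        using m(3) r(2) by (simp add: distrib_right)
      ultimately show "\<exists>m\<ge>1. r * \<delta> powr (\<Sum>i<m. ((real p + 1) / 2) ^ i) \<le> 1 \<and>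
          real m \<le> (1 / l + 1) * (if p = 1 then log 2 r else log ((real p + 1) / 2) (log 2 r))"
        using m True by auto
    qed
  next
    case False
    then have q: "1 < q"
      using \<open>p \<ge> 1\<close> by (simp add: q_def)
    show ?thesis
    proof (rule that)
      \<comment> \<open>The 3 covers the logarithm itself, the rounding and the successor in
        \<open>Suc k\<close>; the other summand covers the division by \<open>l\<close>.\<close>
      show "0 < 3 + \<bar>log q l\<bar>"
        by simp
      fix r :: real
      assume "r \<ge> 2 powr ((real p + 1) / 2)"
      then have r: "0 < r" "q \<le> log 2 r"
        using \<Lambda>[of r] by (auto simp: q_def)
      have "log q q \<le> log q (log 2 r)"
        using r(2) q by (intro log_mono) auto
      then have LL: "1 \<le> log q (log 2 r)"
        using q by simp
      define k where "k = nat \<lceil>log q (log 2 r / l)\<rceil>"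
      have "log q (log 2 r / l) = log q (log 2 r) - log q l"
        using r(2) q l(1) by (subst log_divide) auto
      then have k: "log q (log 2 r / l) \<le> real k" "real k \<le> log q (log 2 r) + \<bar>log q l\<bar> + 1"
        using LL unfolding k_def by linarith+
      have "log 2 r / l \<le> q powr real k"
        using k(1) r(2) q l(1) by (subst (asm) log_le_iff) auto
      also have "\<dots> = q ^ k"
        using q by (simp add: powr_realpow)
      also have "\<dots> \<le> (\<Sum>i<Suc k. q ^ i)"
        using q by (simp add: sum_nonneg)
      finally have "r * \<delta> powr (\<Sum>i<Suc k. q ^ i) \<le> 1"
        by (rule suff[OF r(1)])
      moreover have "real (Suc k) \<le> (3 + \<bar>log q l\<bar>) * log q (log 2 r)"
      proof -
        have "\<bar>log q l\<bar> * 1 \<le> \<bar>log q l\<bar> * log q (log 2 r)"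
          using LL by (intro mult_left_mono) auto
        then show ?thesis
          using k(2) LL by (simp add: algebra_simps)
      qed
      ultimately show "\<exists>m\<ge>1. r * \<delta> powr (\<Sum>i<m. ((real p + 1) / 2) ^ i) \<le> 1 \<and>
          real m \<le> (3 + \<bar>log q l\<bar>) * (if p = 1 then log 2 r else log ((real p + 1) / 2) (log 2 r))"
        using False by (intro exI[of _ "Suc k"]) (auto simp: q_def)
    qed
  qed
qed

section \<open>Convergence of the restarted method\<close>

text \<open>Eliminating \<open>2 * \<mu> * N * V\<close> between the estimate for one epoch and the
  lower bound for \<open>N\<close> leaves the recursion of \<open>superlinear_recursion\<close> for
  the distances at the epoch starts. As \<open>V\<close> is positive, an epoch that starts at the
  solution also ends there.\<close>

lemma restarted_ARE_convergence:
  fixes x xh :: "nat \<Rightarrow> nat \<Rightarrow> 'a::real_inner"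
  assumes "convex X" and p: "p \<ge> 1" and "0 < L" and \<tau>: "0 < \<tau>" "\<tau> \<le> 1" "p = 1 \<or> \<tau> < 1"
    and "0 < \<delta>"
    and mono: "strongly_monotone_on X \<mu> F" and xstar: "xstar \<in> VI X F"
    and N: "N = epoch_length p \<tau> \<delta> L \<mu> (norm (x 1 1 - xstar))"
    and run: "restarted_ARE X F Ft L p N x xh"
    and approx: "\<And>m k z. m \<ge> 1 \<Longrightarrow> k \<in> {1..N} \<Longrightarrow> z \<in> X \<Longrightarrow>
      norm (Ft z (x m k) - F z) \<le> \<tau> * L * norm (z - x m k) ^ p"
    and "m \<ge> 1"
  shows "(norm (ARE_output L p N (x m) (xh m) - xstar))\<^sup>2
    \<le> (norm (x 1 1 - xstar))\<^sup>2 * \<delta> powr (\<Sum>i<m. ((real p + 1) / 2) ^ i)"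
proof -
  define s where "s m = norm (x m 1 - xstar)" for m
  define V where "V = (sqrt (1 - \<tau>\<^sup>2) * sqrt (real N)) ^ (p - 1)"
  have "0 < \<mu>"
    using mono by (simp add: strongly_monotone_on_def)
  have N1: "1 \<le> N"
    using epoch_length_ge_1 N by simp
  have "0 < V"
  proof (cases "p = 1")
    case False
    then have "\<tau>\<^sup>2 < 1"
      using \<tau> by (simp add: power_less_one_iff)
    then show ?thesis
      using N1 by (simp add: V_def)
  qed (simp add: V_def)
  have out: "ARE_output L p N (x m) (xh m) = x (Suc m) 1" if "m \<ge> 1" for m
    using run that by (simp add: restarted_ARE_def)
  have epoch: "2 * \<mu> * (s (Suc m))\<^sup>2 * real N * V \<le> L * ((s m)\<^sup>2 * s m ^ (p - 1))"
    if "m \<ge> 1" for m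
  proof -
    have "ARE_run X F Ft L p N (x m) (xh m)"
      using run that by (simp add: restarted_ARE_def)
    from ARE_epoch[OF \<open>convex X\<close> p \<open>0 < L\<close> \<tau> mono xstar N1 this approx[OF that]]
    show ?thesis
      by (simp add: s_def V_def out[OF that] mult_ac)
  qed
  have N_lower: "L * s 1 ^ (p - 1) \<le> 2 * \<delta> * \<mu> * real N * V"
    using epoch_length_lower_bound[OF p \<tau> \<open>0 < \<delta>\<close> \<open>0 < L\<close> \<open>0 < \<mu>\<close> _ N] by (simp add: s_def V_def)
  have "(s (Suc m))\<^sup>2 \<le> (s 1)\<^sup>2 * \<delta> powr (\<Sum>i<m. ((real p + 1) / 2) ^ i)"
  proof (rule superlinear_recursion[OF p \<open>0 < \<delta>\<close> _ _ _ \<open>m \<ge> 1\<close>])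
    show "0 \<le> s m" for m
      by (simp add: s_def)
    fix m :: nat
    assume m: "1 \<le> m"
    have "L * ((s (Suc m))\<^sup>2 * s 1 ^ (p - 1)) = (s (Suc m))\<^sup>2 * (L * s 1 ^ (p - 1))"
      by simp
    also have "\<dots> \<le> (s (Suc m))\<^sup>2 * (2 * \<delta> * \<mu> * real N * V)"
      using N_lower by (intro mult_left_mono) auto
    also have "\<dots> = \<delta> * (2 * \<mu> * (s (Suc m))\<^sup>2 * real N * V)"
      by simp
    also have "\<dots> \<le> \<delta> * (L * ((s m)\<^sup>2 * s m ^ (p - 1)))"
      using epoch[OF m] \<open>0 < \<delta>\<close> by (intro mult_left_mono) auto
    also have "\<dots> = L * (\<delta> * ((s m)\<^sup>2 * s m ^ (p - 1)))"
      by simp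
    finally show "(s (Suc m))\<^sup>2 * s 1 ^ (p - 1) \<le> \<delta> * ((s m)\<^sup>2 * s m ^ (p - 1))"
      using \<open>0 < L\<close> by simp
    assume "s m = 0"
    then have "2 * \<mu> * (s (Suc m))\<^sup>2 * real N * V \<le> 0"
      using epoch[OF m] by simp
    then show "s (Suc m) = 0"
      using \<open>0 < \<mu>\<close> \<open>0 < V\<close> N1 by (simp add: mult_le_0_iff)
  qed
  then show ?thesis
    using out[OF \<open>m \<ge> 1\<close>] by (simp add: s_def)
qed

section \<open>The epoch length from above, and the complexity bounds\<close>

lemma strong_monotonicity_le_Lipschitz:
  assumes Lip: "Lipschitz_derivative E X 0 L F" and "X \<subseteq> E"
    and mono: "strongly_monotone_on X \<mu> F" and xy: "x \<in> X" "y \<in> X" "x \<noteq> y"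
  shows "\<mu> \<le> L"
proof -
  obtain T where T: "\<And>x. x \<in> E \<Longrightarrow> T x [] = F x"
    and le: "tensor_norm E 0 (\<lambda>vs. T x vs - T y vs) \<le> L * norm (x - y)"
    using Lip xy by (auto simp: Lipschitz_derivative_def derivative_tensors_def)
  \<comment> \<open>For order 0 the supremum runs over the empty tuple only, so the hypothesis is
    Lipschitz continuity of \<open>F\<close> itself.\<close>
  have "{vs. length vs = 0 \<and> (\<forall>v\<in>set vs. v \<in> E \<and> norm v \<le> 1)} = {[]}"
    by auto
  then have "tensor_norm E 0 A = norm (A [])" for A
    by (simp add: tensor_norm_def)
  then have "norm (F x - F y) \<le> L * norm (x - y)"
    using le T[OF subsetD[OF \<open>X \<subseteq> E\<close> xy(1)]] T[OF subsetD[OF \<open>X \<subseteq> E\<close> xy(2)]] by simp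
  then have "norm (F x - F y) * norm (x - y) \<le> L * norm (x - y) * norm (x - y)"
    by (intro mult_right_mono) auto
  moreover have "\<mu> * (norm (x - y))\<^sup>2 \<le> (F x - F y) \<bullet> (x - y)"
    using mono xy by (auto simp: strongly_monotone_on_def)
  moreover have "(F x - F y) \<bullet> (x - y) \<le> norm (F x - F y) * norm (x - y)"
    by (rule norm_cauchy_schwarz)
  ultimately have "\<mu> * (norm (x - y))\<^sup>2 \<le> L * (norm (x - y))\<^sup>2"
    by (simp add: power2_eq_square mult.assoc)
  then show ?thesis
    using xy by simp
qed

text \<open>By \<open>ge1\<close>, rounding up at most doubles the real value. The factors are
  separated so that those in front depend on \<open>p\<close>, \<open>\<tau>\<close> and
  \<open>\<delta>\<close> only.\<close>

lemma epoch_length_upper_bound: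
  assumes "p > 1" "0 < \<tau>" "\<tau> < 1" "0 < \<delta>" "0 < L" "0 < \<mu>" "0 \<le> D0" "D0 \<le> D"
    and ge1: "epoch_length_real p \<tau> \<delta> L \<mu> D0 \<ge> 1"
  shows "real (epoch_length p \<tau> \<delta> L \<mu> D0) \<le>
    2 * (1 / (2 * \<delta>)) powr (2 / (real p + 1)) * (1 / (1 - \<tau>\<^sup>2)) powr ((real p - 1) / (real p + 1)) *
    ((L / \<mu>) powr (2 / (real p + 1)) * (D\<^sup>2) powr ((real p - 1) / (real p + 1)))"
proof -
  let ?a = "2 / (real p + 1)" and ?b = "(real p - 1) / (real p + 1)"
  have \<tau>_sq: "\<tau>\<^sup>2 < 1"
    using assms by (simp add: power_less_one_iff)
  have "real (epoch_length p \<tau> \<delta> L \<mu> D0) \<le> 2 * epoch_length_real p \<tau> \<delta> L \<mu> D0"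
    using ge1 unfolding epoch_length_def by linarith
  also have "epoch_length_real p \<tau> \<delta> L \<mu> D0
      = ((1 / (2 * \<delta>)) * (L / \<mu>)) powr ?a * ((1 / (1 - \<tau>\<^sup>2)) * D0\<^sup>2) powr ?b"
    using \<open>p > 1\<close> by (simp add: epoch_length_real_def)
  also have "\<dots> = (1 / (2 * \<delta>)) powr ?a * (L / \<mu>) powr ?a *
      ((1 / (1 - \<tau>\<^sup>2)) powr ?b * (D0\<^sup>2) powr ?b)"
    using assms \<tau>_sq by (simp only: powr_mult)
  also have "\<dots> \<le> (1 / (2 * \<delta>)) powr ?a * (L / \<mu>) powr ?a *
      ((1 / (1 - \<tau>\<^sup>2)) powr ?b * (D\<^sup>2) powr ?b)"
    using assms by (intro mult_left_mono powr_mono2 power_mono) auto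
  finally show ?thesis
    by (simp add: mult_ac)
qed

text \<open>Rounding up adds at most 1, which \<open>L / \<mu>\<close> dominates.\<close>

lemma epoch_length_upper_bound_1:
  assumes "0 < \<delta>" "0 < \<mu>" "\<mu> \<le> L"
  shows "real (epoch_length 1 \<tau> \<delta> L \<mu> D0) \<le> (1 / (2 * \<delta>) + 1) * (L / \<mu>)"
proof -
  have "0 < L / (2 * \<delta> * \<mu>)"
    using assms by simp
  then have "real (epoch_length 1 \<tau> \<delta> L \<mu> D0) \<le> L / (2 * \<delta> * \<mu>) + 1"
    unfolding epoch_length_def epoch_length_real_def by simp linarith
  also have "\<dots> \<le> L / (2 * \<delta> * \<mu>) + L / \<mu>"
    using assms by simp
  finally show ?thesis
    by (simp add: algebra_simps)
qed

text \<open>The constants \<open>C\<close> and \<open>K\<close> are chosen before the dimension and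
  all problem data. For \<open>p > 1\<close> the iteration bound assumes that the unrounded epoch
  length is at least 1: the number of iterations is a positive integer, whereas the bound can be
  arbitrarily small.\<close>

theorem theorem3p2:
  fixes p :: nat and \<tau> \<delta> :: real
  assumes "p \<ge> 1" and "0 < \<tau>" "\<tau> \<le> 1" and "p = 1 \<or> \<tau> < 1" and "0 < \<delta>" "\<delta> < 1"
  shows "\<exists>C>0. \<exists>K>0. \<forall>(n::nat) (X::fseq set) (D::real) (F::fseq \<Rightarrow> fseq) (Ft::fseq \<Rightarrow> fseq \<Rightarrow> fseq)
            (L::real) (\<mu>::real) (xstar::fseq) (D0::real) (N::nat)
            (x::nat \<Rightarrow> nat \<Rightarrow> fseq) (xh::nat \<Rightarrow> nat \<Rightarrow> fseq) (\<epsilon>::real).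
      X \<subseteq> Rn n \<and> convex X \<and> bounded X \<and> D = diameter X \<and>
      F ` Rn n \<subseteq> Rn n \<and> (\<forall>y\<in>X. (\<lambda>z. Ft z y) ` Rn n \<subseteq> Rn n) \<and>
      L > 0 \<and> Lipschitz_derivative (Rn n) X (p - 1) L F \<and>
      strongly_monotone_on X \<mu> F \<and>
      xstar \<in> VI X F \<and>
      D0 = norm (x 1 1 - xstar) \<and>
      N = epoch_length p \<tau> \<delta> L \<mu> D0 \<and>
      restarted_ARE X F Ft L p N x xh \<and>
      (\<forall>m\<ge>1. \<forall>k\<in>{1..N}. \<forall>z\<in>X. norm (Ft z (x m k) - F z) \<le> \<tau> * L * norm (z - x m k) ^ p) \<and>
      \<epsilon> > 0 \<and> D\<^sup>2 / \<epsilon> \<ge> K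
      \<longrightarrow>
      (\<exists>m\<ge>1.
         (norm (ARE_output L p N (x m) (xh m) - xstar))\<^sup>2 \<le> \<epsilon> \<and>
         (\<forall>j. 1 \<le> j \<and> j < m \<longrightarrow> (norm (ARE_output L p N (x j) (xh j) - xstar))\<^sup>2 > \<epsilon>) \<and>
         (p > 1 \<longrightarrow>
            real m \<le> C * log ((real p + 1) / 2) (log 2 (D\<^sup>2 / \<epsilon>)) \<and>
            (epoch_length_real p \<tau> \<delta> L \<mu> D0 \<ge> 1 \<longrightarrow>
               real (m * N) \<le> C * ((L / \<mu>) powr (2 / (real p + 1)) *
                 (D\<^sup>2) powr ((real p - 1) / (real p + 1)) *
                 log ((real p + 1) / 2) (log 2 (D\<^sup>2 / \<epsilon>))))) \<and>
         (p = 1 \<longrightarrow>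
            real m \<le> C * log 2 (D\<^sup>2 / \<epsilon>) \<and>
            real (m * N) \<le> C * (L / \<mu> * log 2 (D\<^sup>2 / \<epsilon>))))"
proof -
  let ?q = "(real p + 1) / 2"
  obtain C1 where C1: "C1 > 0" "\<And>r. r \<ge> 2 powr ?q \<Longrightarrow>
    \<exists>m\<ge>1. r * \<delta> powr (\<Sum>i<m. ?q ^ i) \<le> 1 \<and>
      real m \<le> C1 * (if p = 1 then log 2 r else log ?q (log 2 r))"
    using epochs_needed[of p \<delta>] assms by blast
  \<comment> \<open>\<open>B\<close> collects the leading constants of the two upper bounds for
    \<open>N\<close>; \<open>C\<close> below dominates both \<open>C1\<close>, for the epochs, and
    \<open>C1 * B\<close>, for the iterations.\<close>
  define B where "B = (if p = 1 then 1 / (2 * \<delta>) + 1 else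
    2 * (1 / (2 * \<delta>)) powr (2 / (real p + 1)) * (1 / (1 - \<tau>\<^sup>2)) powr ((real p - 1) / (real p + 1)))"
  have "0 \<le> B"
    using \<open>0 < \<delta>\<close> by (simp add: B_def)
  define C where "C = C1 * (1 + B)"
  have C: "0 < C" "C1 \<le> C" "C1 * B \<le> C"
    using C1(1) \<open>0 \<le> B\<close> by (auto simp: C_def algebra_simps add_pos_nonneg)
  show ?thesis
  proof (rule exI[of _ C], rule conjI[OF C(1)], rule exI[of _ "2 powr ?q"], rule conjI, simp,
      intro allI impI, elim conjE)
    fix n :: nat and X D F Ft L \<mu> xstar D0 N and x xh :: "nat \<Rightarrow> nat \<Rightarrow> fseq" and \<epsilon> :: real
    assume X: "X \<subseteq> Rn n" "convex X" "bounded X" "D = diameter X"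
      and "L > 0" and Lip: "Lipschitz_derivative (Rn n) X (p - 1) L F"
      and mono: "strongly_monotone_on X \<mu> F" and xstar: "xstar \<in> VI X F"
      and D0: "D0 = norm (x 1 1 - xstar)" and N: "N = epoch_length p \<tau> \<delta> L \<mu> D0"
      and run: "restarted_ARE X F Ft L p N x xh"
      and approx: "\<forall>m\<ge>1. \<forall>k\<in>{1..N}. \<forall>z\<in>X.
        norm (Ft z (x m k) - F z) \<le> \<tau> * L * norm (z - x m k) ^ p"
      and "\<epsilon> > 0" and large: "D\<^sup>2 / \<epsilon> \<ge> 2 powr ?q"
    let ?err = "\<lambda>m. (norm (ARE_output L p N (x m) (xh m) - xstar))\<^sup>2"
    let ?log = "if p = 1 then log 2 (D\<^sup>2 / \<epsilon>) else log ?q (log 2 (D\<^sup>2 / \<epsilon>))"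
    have "0 < \<mu>"
      using mono by (simp add: strongly_monotone_on_def)
    have mem: "x 1 1 \<in> X" "xstar \<in> X"
      using run xstar by (auto simp: restarted_ARE_def ARE_run_def VI_def)
    have "D0 \<le> D"
      using diameter_bounded_bound[OF X(3) mem] by (simp add: D0 X(4) dist_norm)
    obtain M where M: "M \<ge> 1" "D\<^sup>2 / \<epsilon> * \<delta> powr (\<Sum>i<M. ?q ^ i) \<le> 1" "real M \<le> C1 * ?log"
      using C1(2)[OF large] by blast
    have "?err M \<le> D0\<^sup>2 * \<delta> powr (\<Sum>i<M. ?q ^ i)"
      using restarted_ARE_convergence[OF X(2) assms(1) \<open>L > 0\<close> assms(2-5) mono xstar _ run]
        approx N M(1) unfolding D0 by blast
    also have "\<dots> \<le> D\<^sup>2 * \<delta> powr (\<Sum>i<M. ?q ^ i)"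
      using \<open>D0 \<le> D\<close> D0 by (intro mult_right_mono power_mono) auto
    also have "\<dots> \<le> \<epsilon>"
      using M(2) \<open>\<epsilon> > 0\<close> by (simp add: field_simps)
    finally have err: "?err M \<le> \<epsilon>" .
    \<comment> \<open>The epoch \<open>M\<close> meets the accuracy but need not be the first to do
      so; its bound carries over to the least such epoch.\<close>
    define m where "m = (LEAST m. m \<ge> 1 \<and> ?err m \<le> \<epsilon>)"
    have m: "m \<ge> 1 \<and> ?err m \<le> \<epsilon>"
      unfolding m_def by (rule LeastI[of _ M]) (use M err in auto)
    have first: "\<forall>j. 1 \<le> j \<and> j < m \<longrightarrow> ?err j > \<epsilon>"
      unfolding m_def using not_less_Least by (metis (no_types, lifting) not_le)
    have "m \<le> M"
      unfolding m_def by (rule Least_le) (use M err in auto)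
    then have m_le: "real m \<le> C1 * ?log"
      using M(3) by linarith
    \<comment> \<open>A negative logarithm would make the natural number \<open>m\<close>
      negative.\<close>
    have log_nonneg: "0 \<le> ?log"
      using m_le C1(1) by (smt (verit) mult_pos_neg of_nat_0_le_iff)
    have m_bound: "real m \<le> C * ?log"
      using m_le mult_right_mono[OF C(2) log_nonneg] by linarith
    have mN: "real (m * N) \<le> C * (S * ?log)"
      if "real N \<le> B * S" "0 \<le> S" for S
    proof -
      have "real (m * N) \<le> (C1 * ?log) * (B * S)"
        unfolding of_nat_mult using m_le that C1(1) log_nonneg by (intro mult_mono) auto
      also have "\<dots> = (C1 * B) * (S * ?log)"
        by simp
      also have "\<dots> \<le> C * (S * ?log)"
        using C(3) that log_nonneg by (intro mult_right_mono) auto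
      finally show ?thesis .
    qed
    have N_gt1: "real N \<le> B * ((L / \<mu>) powr (2 / (real p + 1)) *
        (D\<^sup>2) powr ((real p - 1) / (real p + 1)))"
      if "p > 1" "epoch_length_real p \<tau> \<delta> L \<mu> D0 \<ge> 1"
      using epoch_length_upper_bound[of p \<tau> \<delta> L \<mu> D0 D] that assms \<open>L > 0\<close> \<open>\<mu> > 0\<close> \<open>D0 \<le> D\<close>
      by (simp add: B_def N D0)
    have N_1: "real N \<le> B * (L / \<mu>)" if "p = 1"
    proof -
      \<comment> \<open>Comparing \<open>\<mu>\<close> with \<open>L\<close> takes two distinct
        points of \<open>X\<close>; a singleton would have diameter 0, contradicting
        \<open>large\<close>.\<close>
      have "\<exists>y\<in>X. y \<noteq> xstar"
      proof (rule ccontr)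
        assume "\<not> ?thesis"
        then have "X = {xstar}"
          using mem by blast
        then have "D = 0"
          using X(4) by simp
        then show False
          using large by (simp add: not_le)
      qed
      then have "\<mu> \<le> L"
        using strong_monotonicity_le_Lipschitz[OF _ X(1) mono _ mem(2), of L] Lip that by auto
      then show ?thesis
        using epoch_length_upper_bound_1[OF \<open>0 < \<delta>\<close> \<open>0 < \<mu>\<close>] that by (simp add: B_def N)
    qed
    show "\<exists>m\<ge>1. ?err m \<le> \<epsilon> \<and> (\<forall>j. 1 \<le> j \<and> j < m \<longrightarrow> ?err j > \<epsilon>) \<and>
         (p > 1 \<longrightarrow>
            real m \<le> C * log ((real p + 1) / 2) (log 2 (D\<^sup>2 / \<epsilon>)) \<and>
            (epoch_length_real p \<tau> \<delta> L \<mu> D0 \<ge> 1 \<longrightarrow>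
               real (m * N) \<le> C * ((L / \<mu>) powr (2 / (real p + 1)) *
                 (D\<^sup>2) powr ((real p - 1) / (real p + 1)) *
                 log ((real p + 1) / 2) (log 2 (D\<^sup>2 / \<epsilon>))))) \<and>
         (p = 1 \<longrightarrow>
            real m \<le> C * log 2 (D\<^sup>2 / \<epsilon>) \<and>
            real (m * N) \<le> C * (L / \<mu> * log 2 (D\<^sup>2 / \<epsilon>)))"
    proof (intro exI[of _ m] conjI impI)
      show "1 \<le> m" "?err m \<le> \<epsilon>" "\<forall>j. 1 \<le> j \<and> j < m \<longrightarrow> ?err j > \<epsilon>"
        using m first by auto
    next
      assume "p > 1"
      then show "real m \<le> C * log ?q (log 2 (D\<^sup>2 / \<epsilon>))"
        using m_bound by simp
    next
      assume "p > 1" "epoch_length_real p \<tau> \<delta> L \<mu> D0 \<ge> 1"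
      then show "real (m * N) \<le> C * ((L / \<mu>) powr (2 / (real p + 1)) *
          (D\<^sup>2) powr ((real p - 1) / (real p + 1)) * log ?q (log 2 (D\<^sup>2 / \<epsilon>)))"
        using mN[OF N_gt1] by simp
    next
      assume "p = 1"
      then show "real m \<le> C * log 2 (D\<^sup>2 / \<epsilon>)"
        using m_bound by simp
    next
      assume "p = 1"
      then show "real (m * N) \<le> C * (L / \<mu> * log 2 (D\<^sup>2 / \<epsilon>))"
        using mN[OF N_1] \<open>L > 0\<close> \<open>0 < \<mu>\<close> by simp
    qed
  qed
qed

end
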